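(* Let $n\ge 1$. For a continuum $K\subset\mathbb{R}^n$ and its $n$-fold sum $K^{+n}$ the following conditions are equivalent: (1) $K^{+n}$ has non-empty interior in $\mathbb{R}^n$; (2) $K^{+n}$ has positive Lebesgue measure in $\mathbb{R}^n$; (3) $K$ is not flat in $\mathbb{R}^n$; (4) for any non-zero linear continuous functional $f:\mathbb{R}^n\to\mathbb{R}$ the image $f(K)$ has non-empty interior in $\mathbb{R}$; (5) $K$ belongs to the family $\mathcal A(\mathbb{R}^n)=\mathcal B(\mathbb{R}^n)$; (6) $K$ belongs to the family $\mathcal C(\mathbb{R}^n)$.
   Context: A continuum is a connected compact metrizable space. A subset $A$ of a real topological vector space $X$ is flat if its affine hull is nowhere dense in $X$ (for $X=\mathbb{R}^n$: the affine hull is not all of $\mathbb{R}^n$). For $T\subset X$ and $m\in\mathbb{N}$, $T^{+m}=T+\dots+T$ ($m$ times) $=\{t_1+\dots+t_m: t_1,\dots,t_m\in T\}$. A function $f:X\to\mathbb{R}$ is additive if $f(x+y)=f(x)+f(y)$ for all $x,y\in X$. A function $f:D\to\mathbb{R}$ on a convex set $D\subset X$ is mid-convex if $f\big(\tfrac{x+y}{2}\big)\le\tfrac{f(x)+f(y)}{2}$ for all $x,y\in D$. $\mathcal A(X)$ is the family of all $T\subset X$ such that every mid-convex function $f:D\to\mathbb{R}$ defined on a convex open set $D\subset X$ containing $T$ is continuous if $\sup f(T)<\infty$. $\mathcal B(X)$ is the family of all $T\subset X$ such that every additive function $f:X\to\mathbb{R}$ with $\sup f(T)<\infty$ is continuous.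 $\mathcal C(X)$ is the family of all $T\subset X$ such that every additive function $f:X\to\mathbb{R}$ for which $f(T)$ is bounded in $\mathbb{R}$ is continuous. It is a known result (Ger and Kominek) that $\mathcal A(\mathbb{R}^n)=\mathcal B(\mathbb{R}^n)$. *)

theory Defs
  imports "HOL-Analysis.Analysis"
begin

definition flat :: "'a::{real_vector,topological_space} set \<Rightarrow> bool" where
  "flat S \<longleftrightarrow> interior (closure (affine hull S)) = {}"

definition fold_sum :: "nat \<Rightarrow> 'a::comm_monoid_add set \<Rightarrow> 'a set" where
  "fold_sum m T = {\<Sum>i<m. t i | t. \<forall>i<m. t i \<in> T}"

text \<open>A function on \<open>D\<close> is represented by a total function whose values outside \<open>D\<close>
  are irrelevant.\<close>

definition mid_convex_on :: "'a::real_vector set \<Rightarrow> ('a \<Rightarrow> real) \<Rightarrow> bool" where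
  "mid_convex_on D f \<longleftrightarrow> (\<forall>x\<in>D. \<forall>y\<in>D. f ((1/2) *\<^sub>R (x + y)) \<le> (f x + f y) / 2)"

text \<open>In the first two families \<open>sup f(T) < \<infinity>\<close> is \<^const>\<open>bdd_above\<close>, which also holds
  for \<open>T = {}\<close> (supremum \<open>-\<infinity>\<close>). \<open>Modules.additive\<close> is Cauchy's functional equation; the
  unqualified name refers to set functions here.\<close>

definition family_A :: "'a::{real_vector,topological_space} set set" where
  "family_A = {T. \<forall>D f. open D \<longrightarrow> convex D \<longrightarrow> T \<subseteq> D \<longrightarrow> mid_convex_on D f \<longrightarrow>
     bdd_above (f ` T) \<longrightarrow> continuous_on D f}"

definition family_B :: "'a::{real_vector,topological_space} set set" where
  "family_B = {T. \<forall>f :: 'a \<Rightarrow> real. Modules.additive f \<longrightarrow> bdd_above (f ` T) \<longrightarrow>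
     continuous_on UNIV f}"

definition family_C :: "'a::{real_vector,topological_space} set set" where
  "family_C = {T. \<forall>f :: 'a \<Rightarrow> real. Modules.additive f \<longrightarrow> bounded (f ` T) \<longrightarrow>
     continuous_on UNIV f}"

end

theory Submission
  imports Defs "HOL-Real_Asymp.Real_Asymp"
begin

text \<open>The main point is that \<open>n K\<close> (the \<open>n\<close>-fold sum) has interior points if \<open>K\<close> is not flat.
  After an affine change of coordinates \<open>K\<close> contains \<open>0\<close> and the unit vectors \<open>e\<^sub>i\<close>. If \<open>K\<close> contains
  paths from \<open>0\<close> to \<open>e\<^sub>i\<close>, extend them by \<open>\<gamma>\<^sub>i (t + 1) = \<gamma>\<^sub>i t + e\<^sub>i\<close>; the map
  \<open>x \<mapsto> \<Sum>\<^sub>i \<gamma>\<^sub>i x\<^sub>i\<close> has bounded distance from the identity and hence is surjective by Brouwer's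
  theorem, so the integer translates of \<open>n K\<close> cover the space. A general \<open>K\<close> has such paths
  in each of its open neighbourhoods, so the translates are dense; as their union is closed, they still
  cover, and Baire's theorem gives an interior point.

  A mid-convex function bounded above on \<open>K\<close> is bounded above on \<open>2\<^sup>-\<^sup>k\<close> times the \<open>2\<^sup>k\<close>-fold sum
  of \<open>K\<close>, which has interior points once \<open>2\<^sup>k \<ge> n\<close>, and the Bernstein--Doetsch theorem applies.
  If \<open>K\<close> lies in a hyperplane \<open>a \<bullet> x = b\<close>, compose \<open>a \<bullet> x\<close> with a discontinuous additive function
  on the reals.\<close>

subsection \<open>Iterated sums and flat sets\<close>

lemma fold_sum_0 [simp]: "fold_sum 0 T = {0}"
  by (auto simp: fold_sum_def)

lemma fold_sum_Suc: "fold_sum (Suc m) T = {x + y |x y. x \<in> fold_sum m T \<and> y \<in> T}"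
proof (intro set_eqI iffI)
  fix z assume "z \<in> {x + y |x y. x \<in> fold_sum m T \<and> y \<in> T}"
  then obtain t y where t: "\<forall>i<m. t i \<in> T" "y \<in> T" and z: "z = (\<Sum>i<m. t i) + y"
    unfolding fold_sum_def by blast
  have "(\<Sum>i<m. t i) = (\<Sum>i<m. (t(m := y)) i)" by (intro sum.cong) auto
  then have "z = (\<Sum>i<Suc m. (t(m := y)) i)" using z by simp
  moreover have "\<forall>i<Suc m. (t(m := y)) i \<in> T" using t by (auto simp: less_Suc_eq)
  ultimately show "z \<in> fold_sum (Suc m) T" unfolding fold_sum_def by blast
next
  fix z assume "z \<in> fold_sum (Suc m) T"
  then obtain t where "\<forall>i<Suc m. t i \<in> T" "z = (\<Sum>i<m. t i) + t m"
    unfolding fold_sum_def by auto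
  then show "z \<in> {x + y |x y. x \<in> fold_sum m T \<and> y \<in> T}"
    unfolding fold_sum_def by (blast intro: less_SucI)
qed

lemma fold_sum_add: "fold_sum (m + k) T = {x + y |x y. x \<in> fold_sum m T \<and> y \<in> fold_sum k T}"
proof (induction k)
  case (Suc k)
  show ?case
    unfolding add_Suc_right fold_sum_Suc Suc.IH
    by (auto simp: add.assoc) (metis add.assoc, blast intro: add.assoc[symmetric])
qed auto

lemma compact_fold_sum:
  fixes T :: "'a::real_normed_vector set"
  assumes "compact T"
  shows "compact (fold_sum m T)"
  by (induction m) (simp_all add: fold_sum_Suc compact_sums assms)

lemma fold_sum_image_affine:
  fixes L :: "'a::real_vector \<Rightarrow> 'b::real_vector"
  assumes "linear L"
  shows "fold_sum m ((\<lambda>x. L x + c) ` T) = (\<lambda>x. L x + real m *\<^sub>R c) ` fold_sum m T"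
proof (induction m)
  case (Suc m)
  show ?case
    unfolding fold_sum_Suc Suc.IH
    by (auto simp: image_iff linear_add[OF assms] algebra_simps)
      (metis (no_types, lifting) add.assoc add.commute linear_add[OF assms])+
qed (simp add: linear_0[OF assms])

text \<open>Adding \<open>k\<close> copies of one point of \<open>T\<close> places a translate of
  the \<open>m\<close>-fold sum inside the larger sum.\<close>

lemma interior_fold_sum_mono:
  fixes T :: "'a::real_normed_vector set"
  assumes "interior (fold_sum m T) \<noteq> {}" "T \<noteq> {}"
  shows "interior (fold_sum (m + k) T) \<noteq> {}"
proof -
  obtain a where "a \<in> T" using assms by blast
  then have "(\<Sum>i<k. a) \<in> fold_sum k T" unfolding fold_sum_def by blast
  then have "(\<lambda>x. (\<Sum>i<k. a) + x) ` fold_sum m T \<subseteq> fold_sum (m + k) T"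
    unfolding fold_sum_add by (auto simp: add.commute)
  from interior_mono[OF this] show ?thesis
    using assms(1) by (auto simp: interior_translation simp del: sum_constant_scaleR)
qed

text \<open>Finite-dimensional affine hulls are closed, so flatness means that the hull has empty
  interior, and a convex set with empty interior lies in a hyperplane.\<close>

lemma flat_iff_subset_hyperplane:
  fixes S :: "'a::euclidean_space set"
  shows "flat S \<longleftrightarrow> (\<exists>a b. a \<noteq> 0 \<and> S \<subseteq> {x. a \<bullet> x = b})"
proof
  assume "flat S"
  then have "interior (affine hull S) = {}"
    by (simp add: flat_def closure_closed)
  then obtain a b where "a \<noteq> 0" "affine hull S \<subseteq> {x. a \<bullet> x = b}"
    using empty_interior_subset_hyperplane[OF affine_imp_convex[OF affine_affine_hull]] by metis
  then show "\<exists>a b. a \<noteq> 0 \<and> S \<subseteq> {x. a \<bullet> x = b}"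
    using subset_trans[OF hull_subset[of S affine]] by (intro exI[of _ a] exI[of _ b] conjI)
next
  assume "\<exists>a b. a \<noteq> 0 \<and> S \<subseteq> {x. a \<bullet> x = b}"
  then obtain a b where ab: "a \<noteq> 0" "S \<subseteq> {x. a \<bullet> x = b}" by blast
  then have "affine hull S \<subseteq> {x. a \<bullet> x = b}"
    by (intro hull_minimal affine_hyperplane)
  then have "interior (affine hull S) \<subseteq> interior {x. a \<bullet> x = b}" by (rule interior_mono)
  then show "flat S" using ab by (simp add: flat_def closure_closed interior_hyperplane)
qed

text \<open>A sum of \<open>m\<close> points of the hyperplane \<open>a \<bullet> x = b\<close> lies
  on a parallel hyperplane, which is a null set.\<close>

lemma negligible_fold_sum_flat:
  fixes S :: "'a::euclidean_space set"
  assumes "flat S"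
  shows "negligible (fold_sum m S)"
proof (cases "m = 0")
  case False
  obtain a b where ab: "a \<noteq> 0" "S \<subseteq> {x. a \<bullet> x = b}"
    using assms flat_iff_subset_hyperplane by blast
  then have "a \<bullet> t i = b" if "\<forall>i<m. t i \<in> S" "i < m" for t i
    using that by blast
  then have "fold_sum m S \<subseteq> {x. a \<bullet> x = real m * b}"
    by (auto simp: fold_sum_def inner_sum_right)
  then show ?thesis
    using negligible_hyperplane ab(1) negligible_subset by blast
qed simp

text \<open>Functionals are inner products with a fixed vector. The image of a connected set is an
  interval, which has interior points unless the set lies in a single level set, that is, in a
  hyperplane.\<close>

lemma flat_iff_image_functional:
  fixes S :: "'a::euclidean_space set"
  assumes "connected S"
  shows "\<not> flat S \<longleftrightarrow> (\<forall>f :: 'a \<Rightarrow> real. linear f \<longrightarrow> continuous_on UNIV f \<longrightarrow> f \<noteq> (\<lambda>x. 0) \<longrightarrow>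
    interior (f ` S) \<noteq> {})"
proof (intro iffI allI impI)
  fix f :: "'a \<Rightarrow> real"
  assume nf: "\<not> flat S" and f: "linear f" "continuous_on UNIV f" "f \<noteq> (\<lambda>x. 0)"
  \<comment> \<open>The vector is \<open>adjoint f 1\<close>, since
    \<open>f x = f x \<bullet> 1\<close>.\<close>
  obtain a where a: "\<And>x. f x = a \<bullet> x"
    by (metis f(1) adjoint_works inner_commute inner_real_def mult.right_neutral)
  with f(3) have "a \<noteq> 0" by auto
  then have "S \<noteq> {}" "\<not> S \<subseteq> {x. a \<bullet> x = b}" for b
    using nf unfolding flat_iff_subset_hyperplane by blast+
  then obtain x y where xy: "x \<in> S" "y \<in> S" "f x < f y"
    unfolding a by (metis (mono_tags, lifting) all_not_in_conv linorder_neqE mem_Collect_eq subsetI)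
  have "is_interval (f ` S)"
    using connected_continuous_image[OF continuous_on_subset[OF f(2)] assms]
    by (simp add: is_interval_connected_1)
  then have "{f x..f y} \<subseteq> f ` S"
    using xy by (auto simp: is_interval_1)
  then have "interior {f x..f y} \<subseteq> interior (f ` S)" by (rule interior_mono)
  then show "interior (f ` S) \<noteq> {}" using xy(3) by (auto simp: interior_atLeastAtMost_real)
next
  assume *: "\<forall>f :: 'a \<Rightarrow> real. linear f \<longrightarrow> continuous_on UNIV f \<longrightarrow> f \<noteq> (\<lambda>x. 0) \<longrightarrow>
    interior (f ` S) \<noteq> {}"
  show "\<not> flat S"
  proof
    assume "flat S"
    then obtain a b where ab: "a \<noteq> 0" "S \<subseteq> {x. a \<bullet> x = b}"
      using flat_iff_subset_hyperplane by blast
    have "(\<lambda>x. a \<bullet> x) \<noteq> (\<lambda>x. 0)" using ab(1) by (metis inner_eq_zero_iff)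
    then have "interior ((\<lambda>x. a \<bullet> x) ` S) \<noteq> {}"
      using * by (simp add: linear_conv_bounded_linear bounded_linear_inner_right continuous_intros)
    moreover have "(\<lambda>x. a \<bullet> x) ` S \<subseteq> {b}" using ab by auto
    ultimately show False
      using interior_mono[of "(\<lambda>x. a \<bullet> x) ` S" "{b}"] by simp
  qed
qed

subsection \<open>Mid-convex and additive functions\<close>

lemma mid_convex_on_midpoint:
  "mid_convex_on D f \<Longrightarrow> x \<in> D \<Longrightarrow> y \<in> D \<Longrightarrow> f ((1/2) *\<^sub>R (x + y)) \<le> (f x + f y) / 2"
  by (simp add: mid_convex_on_def)

text \<open>Repeated halving towards \<open>z\<close>: each step takes the midpoint of
  \<open>z\<close> and the previous point, which halves the bound on the excess over
  \<open>f z\<close>.\<close>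

lemma mid_convex_on_dyadic:
  fixes x z :: "'a::real_vector"
  assumes f: "mid_convex_on D f" and D: "convex D" and xz: "x \<in> D" "z \<in> D"
  shows "f (z + (1/2^k) *\<^sub>R (x - z)) \<le> f z + (f x - f z) / 2^k"
proof (induction k)
  case (Suc k)
  let ?u = "z + (1/2^k) *\<^sub>R (x - z)"
  have "?u = (1 - 1/2^k) *\<^sub>R z + (1/2^k) *\<^sub>R x" by (simp add: algebra_simps)
  also have "\<dots> \<in> D" using D xz by (intro convexD) auto
  finally have "f ((1/2) *\<^sub>R (z + ?u)) \<le> (f z + f ?u) / 2"
    using mid_convex_on_midpoint[OF f xz(2)] by blast
  also have "(1/2) *\<^sub>R (z + ?u) = z + (1/2^Suc k) *\<^sub>R (x - z)"
    by (simp add: scaleR_add_right scaleR_2[symmetric] add.assoc[symmetric])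
  also have "(f z + f ?u) / 2 \<le> (f z + (f z + (f x - f z) / 2^k)) / 2"
    by (intro divide_right_mono add_left_mono Suc.IH) simp
  also have "\<dots> = f z + (f x - f z) / 2^Suc k" by (simp add: field_simps)
  finally show ?case .
qed simp

text \<open>A homothety carries the bound near \<open>x0\<close> to a neighbourhood of any
  \<open>y\<close>. There, dyadic contraction makes the upper bound tend to \<open>f y\<close>, and
  reflection in \<open>y\<close> turns it into a lower bound.\<close>

theorem bernstein_doetsch:
  fixes f :: "'a::real_normed_vector \<Rightarrow> real"
  assumes D: "open D" "convex D" and f: "mid_convex_on D f"
    and r: "r > 0" "ball x0 r \<subseteq> D" and bound: "\<And>x. x \<in> ball x0 r \<Longrightarrow> f x \<le> C"
  shows "continuous_on D f"
proof (rule continuous_at_imp_continuous_on, rule ballI)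
  fix y assume y: "y \<in> D"
  obtain e where e: "e > 0" "ball y e \<subseteq> D" using D(1) y open_contains_ball by blast
  have "\<forall>\<^sub>F k in sequentially. norm ((1/(2^k - 1)) *\<^sub>R (y - x0)) < e"
  proof (rule order_tendstoD)
    show "(\<lambda>k. norm ((1/(2^k - 1)) *\<^sub>R (y - x0))) \<longlonglongrightarrow> 0"
    proof -
      have "(\<lambda>k. 1/(2^k - 1) :: real) \<longlonglongrightarrow> 0" by real_asymp
      then have "(\<lambda>k. norm ((1/(2^k - 1)) *\<^sub>R (y - x0))) \<longlonglongrightarrow> norm (0 *\<^sub>R (y - x0))"
        by (intro tendsto_intros)
      then show ?thesis by simp
    qed
  qed (use e in simp)
  then obtain N where N: "\<And>k. k \<ge> N \<Longrightarrow> norm ((1/(2^k - 1)) *\<^sub>R (y - x0)) < e"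
    unfolding eventually_sequentially by blast
  \<comment> \<open>The successor keeps \<open>2^k - 1\<close> nonzero. The point \<open>z\<close>
    lies beyond \<open>y\<close> on the ray from \<open>x0\<close>, so that \<open>y\<close> divides
    the segment from \<open>z\<close> to \<open>x0\<close> in the ratio
    \<open>1 : 2^k - 1\<close>.\<close>
  define k where "k = Suc N"
  define z where "z = y + (1/(2^k - 1)) *\<^sub>R (y - x0)"
  have z: "z \<in> D" using N[of k] e by (auto simp: k_def z_def dist_norm)
  have k1: "(2::real)^k > 1" unfolding k_def by (rule one_less_power) auto
  have yz: "y = z + (1/2^k) *\<^sub>R (x0 - z)"
  proof -
    have "(2^k - 1) *\<^sub>R z = 2^k *\<^sub>R y - x0"
      using k1 by (simp add: z_def algebra_simps)
    then have "2^k *\<^sub>R y = 2^k *\<^sub>R z + (x0 - z)" by (simp add: algebra_simps)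
    then have "(1/2^k) *\<^sub>R 2^k *\<^sub>R y = (1/2^k) *\<^sub>R (2^k *\<^sub>R z + (x0 - z))" by simp
    then show ?thesis by (simp add: scaleR_add_right)
  qed
  \<comment> \<open>The homothety with centre \<open>z\<close> and ratio \<open>1/2^k\<close> maps
    \<open>ball x0 r\<close> onto \<open>ball y s\<close>; \<open>B\<close> is the bound that
    \<open>mid_convex_on_dyadic\<close> gives there.\<close>
  define s where "s = r / 2^k"
  define B where "B = f z + (C - f z) / 2^k"
  have s: "s > 0" using r by (simp add: s_def)
  have B: "y + h \<in> D" "f (y + h) \<le> B" if "norm h < s" for h
  proof -
    let ?x = "x0 + 2^k *\<^sub>R h"
    have "norm (2^k *\<^sub>R h) < r" using that by (simp add: s_def field_simps)
    then have x: "?x \<in> ball x0 r" by (simp add: dist_norm)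
    have eq: "y + h = z + (1/2^k) *\<^sub>R (?x - z)"
      by (subst yz) (simp add: algebra_simps)
    also have "\<dots> = (1 - 1/2^k) *\<^sub>R z + (1/2^k) *\<^sub>R ?x" by (simp add: algebra_simps)
    also have "\<dots> \<in> D" using D z x r by (intro convexD) auto
    finally show "y + h \<in> D" .
    have "f (y + h) \<le> f z + (f ?x - f z) / 2^k"
      unfolding eq using mid_convex_on_dyadic[OF f D(2) _ z] x r(2) by blast
    also have "\<dots> \<le> B" using bound[OF x] by (simp add: B_def divide_right_mono)
    finally show "f (y + h) \<le> B" .
  qed
  \<comment> \<open>\<open>h\<close> is the contraction by \<open>2^j\<close> of a vector shorter
    than \<open>s\<close>, for which the bound \<open>B\<close> is available.\<close>
  have up: "f (y + h) \<le> f y + (B - f y) / 2^j" if "norm h < s / 2^j" for h j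
  proof -
    have n: "norm (2^j *\<^sub>R h) < s" using that by (simp add: field_simps)
    have "f (y + (1/2^j) *\<^sub>R (y + 2^j *\<^sub>R h - y)) \<le> f y + (f (y + 2^j *\<^sub>R h) - f y) / 2^j"
      using mid_convex_on_dyadic[OF f D(2) B(1)[OF n] y] .
    also have "\<dots> \<le> f y + (B - f y) / 2^j" using B(2)[OF n] by (simp add: divide_right_mono)
    finally show ?thesis by simp
  qed
  \<comment> \<open>\<open>y\<close> is the midpoint of \<open>y + h\<close> and
    \<open>y - h\<close>, so an upper bound at \<open>y - h\<close> forces a lower bound at
    \<open>y + h\<close>.\<close>
  have lo: "f (y + h) \<ge> f y - (B - f y) / 2^j" if h: "norm h < s / 2^j" for h j
  proof -
    have "s / 2^j \<le> s" using s by (simp add: field_simps)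
    with h have "y + h \<in> D" "y - h \<in> D" using B(1)[of h] B(1)[of "-h"] by auto
    from mid_convex_on_midpoint[OF f this]
    have "f y \<le> (f (y + h) + f (y - h)) / 2" by (simp add: scaleR_2[symmetric])
    with up[of "-h" j] h show ?thesis by simp
  qed
  show "isCont f y"
    unfolding continuous_at_eps_delta
  proof (intro allI impI)
    fix \<epsilon> :: real assume "\<epsilon> > 0"
    have "(\<lambda>j. (B - f y) / 2^j) \<longlonglongrightarrow> 0" by real_asymp
    then obtain j where j: "(B - f y) / 2^j < \<epsilon>"
      using order_tendstoD(2)[OF _ \<open>\<epsilon> > 0\<close>] eventually_happens'[OF sequentially_bot] by blast
    have "dist (f x) (f y) < \<epsilon>" if "dist x y < s / 2^j" for x
      using up[of "x - y" j] lo[of "x - y" j] j that by (auto simp: dist_norm)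
    then show "\<exists>d>0. \<forall>x. dist x y < d \<longrightarrow> dist (f x) (f y) < \<epsilon>"
      using s by (intro exI[of _ "s / 2^j"]) auto
  qed
qed

text \<open>An average of \<open>2^Suc k\<close> points is the midpoint of two averages of
  \<open>2^k\<close> points, hence the restriction to powers of two.\<close>

lemma mid_convex_on_fold_sum:
  fixes T :: "'a::real_vector set"
  assumes f: "mid_convex_on D f" and D: "convex D" and T: "T \<subseteq> D" "\<And>x. x \<in> T \<Longrightarrow> f x \<le> C"
    and t: "t \<in> fold_sum (2^k) T"
  shows "(1/2^k) *\<^sub>R t \<in> D \<and> f ((1/2^k) *\<^sub>R t) \<le> C"
  using t
proof (induction k arbitrary: t)
  case 0
  then have "t \<in> T" using fold_sum_Suc[of 0 T] by auto
  then show ?case using T by auto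
next
  case (Suc k)
  then obtain u v where uv: "u \<in> fold_sum (2^k) T" "v \<in> fold_sum (2^k) T" "t = u + v"
    using fold_sum_add[of "2^k" "2^k" T] by (auto simp: mult_2)
  let ?u = "(1/2^k) *\<^sub>R u" and ?v = "(1/2^k) *\<^sub>R v"
  have IH: "?u \<in> D" "f ?u \<le> C" "?v \<in> D" "f ?v \<le> C" using Suc.IH uv by auto
  have eq: "(1/2^Suc k) *\<^sub>R t = (1/2) *\<^sub>R (?u + ?v)"
    by (simp add: uv scaleR_add_right)
  have "(1/2) *\<^sub>R ?u + (1/2) *\<^sub>R ?v \<in> D" using D IH by (intro convexD) auto
  moreover have "f ((1/2) *\<^sub>R (?u + ?v)) \<le> C"
    using mid_convex_on_midpoint[OF f IH(1,3)] IH by simp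
  ultimately show ?case unfolding eq by (simp add: scaleR_add_right)
qed

text \<open>A ball in a \<open>2^m\<close>-fold sum, scaled by \<open>1/2^m\<close>, becomes a ball
  in \<open>D\<close> on which \<open>f\<close> keeps its upper bound from \<open>T\<close>, so the
  Bernstein-Doetsch theorem applies.\<close>

lemma interior_fold_sum_imp_family_A:
  fixes T :: "'a::real_normed_vector set"
  assumes int: "interior (fold_sum m T) \<noteq> {}" and ne: "T \<noteq> {}"
  shows "T \<in> family_A"
  unfolding family_A_def
proof (intro CollectI allI impI)
  fix D and f :: "'a \<Rightarrow> real"
  assume D: "open D" "convex D" "T \<subseteq> D" and f: "mid_convex_on D f" and "bdd_above (f ` T)"
  then obtain C where C: "\<And>x. x \<in> T \<Longrightarrow> f x \<le> C" by (auto simp: bdd_above_def)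
  \<comment> \<open>Raises the number of summands from \<open>m\<close> to a power of two.\<close>
  have "m \<le> 2^m" by simp
  then have "interior (fold_sum (2^m) T) \<noteq> {}"
    using interior_fold_sum_mono[OF int ne, of "2^m - m"] by simp
  then obtain x r where r: "r > 0" "ball x r \<subseteq> fold_sum (2^m) T"
    by (auto simp: mem_interior)
  have "y \<in> D \<and> f y \<le> C" if "y \<in> ball ((1/2^m) *\<^sub>R x) (r/2^m)" for y
  proof -
    have "x - 2^m *\<^sub>R y = 2^m *\<^sub>R ((1/2^m) *\<^sub>R x - y)" by (simp add: algebra_simps)
    then have "dist x (2^m *\<^sub>R y) = 2^m * dist ((1/2^m) *\<^sub>R x) y" by (simp add: dist_norm)
    also have "\<dots> < r" using that by (simp add: field_simps)
    finally have "2^m *\<^sub>R y \<in> fold_sum (2^m) T" using r by auto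
    from mid_convex_on_fold_sum[OF f D(2,3) C this] show ?thesis by simp
  qed
  then show "continuous_on D f"
    by (intro bernstein_doetsch[OF D(1,2) f, of "r/2^m" "(1/2^m) *\<^sub>R x" C]) (use r in auto)
qed

lemma additive_imp_mid_convex_on:
  fixes f :: "'a::real_vector \<Rightarrow> real"
  assumes "Modules.additive f"
  shows "mid_convex_on D f"
proof -
  have add: "f (x + y) = f x + f y" for x y using assms by (simp add: Modules.additive_def)
  have "2 * f ((1/2) *\<^sub>R (x + y)) = f x + f y" for x y
    using add[of "(1/2) *\<^sub>R (x + y)" "(1/2) *\<^sub>R (x + y)"] add[of x y]
    by (simp add: scaleR_add_left[symmetric])
  then show ?thesis by (auto simp: mid_convex_on_def field_simps)
qed

lemma family_A_subset_family_B: "family_A \<subseteq> (family_B :: 'a::real_normed_vector set set)"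
  using additive_imp_mid_convex_on by (fastforce simp: family_A_def family_B_def)

lemma family_B_subset_family_C: "family_B \<subseteq> (family_C :: 'a::real_normed_vector set set)"
  by (auto simp: family_B_def family_C_def bounded_imp_bdd_above)

text \<open>A rational-linear map with value 0 at 1 and value 1 at an irrational \<open>r\<close>
  vanishes on the dense set of rationals without being zero.\<close>

lemma exists_discontinuous_additive:
  obtains g :: "real \<Rightarrow> real" where "Modules.additive g" "\<not> continuous_on UNIV g"
proof -
  interpret Q: vector_space_pair "\<lambda>q x. of_rat q * (x::real)" "\<lambda>q x. of_rat q * (x::real)"
    by unfold_locales (simp_all add: algebra_simps of_rat_add of_rat_mult)
  obtain r :: real where r: "r \<notin> \<rat>"
    using countable_rat uncountable_UNIV_real by (metis UNIV_eq_I)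
  have "r \<notin> Q.vs1.span {1}" using r by (auto simp: Q.vs1.span_singleton)
  then have "Q.vs1.independent {r, 1}" by (simp add: Q.vs1.independent_insert)
  then obtain g where g: "Vector_Spaces.linear (\<lambda>q x. of_rat q * (x::real)) (\<lambda>q x. of_rat q * x) g"
      "\<forall>x\<in>{r, 1}. g x = (if x = r then 1 else (0::real))"
    using Q.linear_independent_extend[of "{r, 1}" "\<lambda>x. if x = r then 1 else 0"] by blast
  interpret g: Vector_Spaces.linear "\<lambda>q x. of_rat q * (x::real)" "\<lambda>q x. of_rat q * (x::real)" g by fact
  have "r \<noteq> 1" using r by auto
  then have g1: "g 1 = 0" "g r = 1" using g(2) by auto
  have "g x = 0" if "x \<in> \<rat>" for x
    using that g.scale[of _ 1] g1 by (auto elim!: Rats_cases)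
  moreover have "closure \<rat> = (UNIV :: real set)" by (rule Rats_closure_real)
  ultimately have "\<not> continuous_on UNIV g"
    using continuous_constant_on_closure[of \<rat> g 0 r] g1(2) by auto
  moreover have "Modules.additive g" by (simp add: Modules.additive_def g.add)
  ultimately show ?thesis using that by blast
qed

text \<open>On a set inside a hyperplane \<open>a \<bullet> x = b\<close>, the additive function
  \<open>g (a \<bullet> x)\<close> is constant, hence bounded, although \<open>g\<close> is
  discontinuous.\<close>

lemma family_C_imp_not_flat:
  fixes T :: "'a::euclidean_space set"
  assumes "T \<in> family_C"
  shows "\<not> flat T"
proof
  assume "flat T"
  then obtain a b where ab: "a \<noteq> 0" "T \<subseteq> {x. a \<bullet> x = b}"
    using flat_iff_subset_hyperplane by blast
  obtain g :: "real \<Rightarrow> real" where g: "Modules.additive g" "\<not> continuous_on UNIV g"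
    by (rule exists_discontinuous_additive)
  let ?f = "\<lambda>x. g (a \<bullet> x)"
  have "Modules.additive ?f" using g(1) by (simp add: Modules.additive_def inner_add_right)
  moreover have "?f ` T \<subseteq> {g b}" using ab by auto
  then have "bounded (?f ` T)" by (rule bounded_subset[rotated]) simp
  ultimately have "continuous_on UNIV ?f" using assms by (auto simp: family_C_def)
  \<comment> \<open>Along the line spanned by \<open>a\<close>, parametrised so that the inner
    product with \<open>a\<close> is \<open>t\<close>, the composite is \<open>g\<close>
    itself.\<close>
  then have "continuous_on UNIV (\<lambda>t. ?f ((t / (a \<bullet> a)) *\<^sub>R a))"
    by (rule continuous_on_compose2) (use ab in \<open>auto intro!: continuous_intros\<close>)
  then show False using g(2) ab(1) by simp
qed

subsection \<open>Sums of non-flat continua\<close>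

text \<open>A solution of \<open>f x = y\<close> is a fixed point of
  \<open>x \<mapsto> y - (f x - x)\<close>, which maps the ball of radius \<open>B\<close> about
  \<open>y\<close> into itself.\<close>

lemma surj_of_bounded_perturbation:
  fixes f :: "'a::euclidean_space \<Rightarrow> 'a"
  assumes "continuous_on UNIV f" "bounded (range (\<lambda>x. f x - x))"
  shows "surj f"
proof -
  obtain B where B: "\<And>x. norm (f x - x) \<le> B"
    using assms(2) by (auto simp: bounded_iff)
  have "\<exists>x. f x = y" for y
  proof -
    let ?g = "\<lambda>x. y - (f x - x)"
    have "B \<ge> 0" using B[of 0] norm_ge_zero by (rule order_trans[rotated])
    then have "compact (cball y B)" "convex (cball y B)" "cball y B \<noteq> {}" by auto
    moreover have "continuous_on (cball y B) ?g"
      using continuous_on_subset[OF assms(1)] by (intro continuous_intros) auto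
    moreover have "?g \<in> cball y B \<rightarrow> cball y B" using B by (auto simp: dist_norm)
    ultimately obtain x where "?g x = x" by (rule brouwer)
    then show ?thesis by (intro exI[of _ x]) (simp add: algebra_simps)
  qed
  then show ?thesis by (metis surjI surj_def)
qed

text \<open>A loop factors through the unit circle; composing that factor with the winding map
  \<open>e\<close> extends the loop with period 1.\<close>

lemma loop_periodic_extension:
  fixes p :: "real \<Rightarrow> 'a::real_normed_vector"
  assumes "path p" "pathstart p = pathfinish p"
  obtains g where "continuous_on UNIV g" "\<And>t::real. \<exists>s\<in>{0..1}. t - s \<in> \<int> \<and> g t = p s"
proof -
  define P where "P = p \<circ> (\<lambda>z. Arg2pi z / (2*pi))"
  \<comment> \<open>The trivial homotopy from \<open>p\<close> to itself yields continuity of the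
    induced circle map, even across the jump of \<open>Arg2pi\<close>.\<close>
  have "homotopic_loops UNIV p p" using assms by (simp add: homotopic_loops_refl)
  then have P: "continuous_on (sphere 0 1) P"
    unfolding P_def
    by (intro homotopic_with_imp_continuous[THEN conjunct1, OF homotopic_loops_imp_homotopic_circlemaps])
  define e where "e t = exp (\<i> * of_real (2*pi*t))" for t :: real
  show thesis
  proof (rule that[of "\<lambda>t. P (e t)"])
    show "continuous_on UNIV (\<lambda>t. P (e t))"
      by (rule continuous_on_compose2[OF P]) (auto simp: e_def norm_exp_eq_Re intro!: continuous_intros)
  next
    fix t :: real
    let ?s = "Arg2pi (e t) / (2*pi)"
    have "norm (e t) = 1" by (simp add: e_def norm_exp_eq_Re)
    then have "e t = exp (\<i> * of_real (Arg2pi (e t)))"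
      using Arg2pi_eq[of "e t"] by simp
    then obtain n :: int where "\<i> * of_real (2*pi*t) = \<i> * of_real (Arg2pi (e t)) + (of_int (2 * n) * pi) * \<i>"
      unfolding e_def exp_eq by blast
    then have "2*pi*t = Arg2pi (e t) + 2 * n * pi"
      by (auto simp: complex_eq_iff)
    then have "t - ?s = of_int n" by (simp add: field_simps)
    moreover have "?s \<in> {0..1}" using Arg2pi[of "e t"] by (auto simp: field_simps)
    ultimately show "\<exists>s\<in>{0..1}. t - s \<in> \<int> \<and> P (e t) = p s"
      by (intro bexI[of _ ?s]) (auto simp: P_def)
  qed
qed

text \<open>Subtracting \<open>t *\<^sub>R b\<close> closes the path into a loop. Its periodic
  extension is bounded, and the linear part is then added back.\<close>

lemma path_quasiperiodic_extension:
  fixes p :: "real \<Rightarrow> 'a::real_normed_vector"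
  assumes "path p" "pathstart p = 0" "pathfinish p = b"
  obtains h where "continuous_on UNIV h" "bounded (range (\<lambda>t. h t - t *\<^sub>R b))"
    "\<And>t::real. \<exists>s\<in>{0..1}. \<exists>m\<in>\<int>. h t = p s + m *\<^sub>R b"
proof -
  let ?q = "\<lambda>t. p t - t *\<^sub>R b"
  have q: "path ?q" using assms(1) unfolding path_def by (intro continuous_intros)
  have "pathstart ?q = pathfinish ?q"
    using assms by (simp add: pathstart_def pathfinish_def)
  then obtain g where g: "continuous_on UNIV g" "\<And>t::real. \<exists>s\<in>{0..1}. t - s \<in> \<int> \<and> g t = ?q s"
    using loop_periodic_extension[OF q] by blast
  show thesis
  proof (rule that[of "\<lambda>t. g t + t *\<^sub>R b"])
    show "continuous_on UNIV (\<lambda>t. g t + t *\<^sub>R b)" by (intro continuous_intros g)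
    have "range g \<subseteq> path_image ?q" using g(2) unfolding path_image_def by blast
    then show "bounded (range (\<lambda>t. g t + t *\<^sub>R b - t *\<^sub>R b))"
      using bounded_path_image[OF q] bounded_subset by auto
  next
    fix t :: real
    obtain s where "s \<in> {0..1}" "t - s \<in> \<int>" "g t = ?q s" using g(2) by blast
    \<comment> \<open>The loop value at \<open>s\<close> already contains
      \<open>- s *\<^sub>R b\<close>, so the multiple of \<open>b\<close> left over is the integer
      \<open>t - s\<close>.\<close>
    then show "\<exists>s\<in>{0..1}. \<exists>m\<in>\<int>. g t + t *\<^sub>R b = p s + m *\<^sub>R b"
      by (intro bexI[of _ s] bexI[of _ "t - s"]) (auto simp: algebra_simps)
  qed
qed

text \<open>\<open>K\<close> itself may fail to be path-connected, but its
  \<open>d\<close>-neighbourhood is open and connected, hence path-connected.\<close>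

lemma path_near_connected:
  fixes K :: "'a::real_normed_vector set"
  assumes "connected K" "a \<in> K" "b \<in> K" "d > 0"
  obtains p where "path p" "pathstart p = a" "pathfinish p = b"
    "\<And>s. s \<in> {0..1} \<Longrightarrow> \<exists>k\<in>K. dist (p s) k < d"
proof -
  define U where "U = (\<Union>x\<in>K. \<Union>y\<in>ball 0 d. {x + y})"
  have "open U" unfolding U_def by (rule open_sums) simp
  moreover have "U = (\<lambda>z. fst z + snd z) ` (K \<times> ball 0 d)" by (force simp: U_def)
  then have "connected U"
    using assms(1) by (auto intro!: connected_continuous_image connected_Times continuous_intros)
  ultimately have "path_connected U" by (rule connected_open_path_connected)
  moreover have "K \<subseteq> U" using assms(4) by (force simp: U_def)
  ultimately obtain p where p: "path p" "path_image p \<subseteq> U" "pathstart p = a" "pathfinish p = b"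
    using assms(2,3) unfolding path_connected_def by blast
  have "\<exists>k\<in>K. dist (p s) k < d" if "s \<in> {0..1}" for s
  proof -
    have "p s \<in> U" using p(2) that by (auto simp: path_image_def)
    then obtain x y where "x \<in> K" "norm y < d" "p s = x + y" by (auto simp: U_def)
    then show ?thesis by (intro bexI[of _ x]) (auto simp: dist_norm)
  qed
  with p that show thesis by blast
qed

lemma sum_UNIV_in_fold_sum:
  fixes k :: "'n::finite \<Rightarrow> 'a::comm_monoid_add"
  assumes "\<And>i. k i \<in> K"
  shows "(\<Sum>i\<in>UNIV. k i) \<in> fold_sum CARD('n) K"
proof -
  obtain \<phi> where \<phi>: "bij_betw \<phi> {..<CARD('n)} (UNIV :: 'n set)"
    using ex_bij_betw_nat_finite[of "UNIV :: 'n set"] by (auto simp: atLeast0LessThan)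
  have "(\<Sum>i\<in>UNIV. k i) = (\<Sum>j<CARD('n). k (\<phi> j))"
    using sum.reindex_bij_betw[OF \<phi>, of k] by simp
  then show ?thesis unfolding fold_sum_def using assms by blast
qed

text \<open>The map \<open>x \<mapsto> \<Sum>i. h i (x $ i)\<close>, built from quasiperiodic extensions of paths near \<open>K\<close>
  joining \<open>0\<close> to the unit vectors, is a bounded perturbation of the identity.\<close>

lemma fold_sum_plus_lattice_dense:
  fixes K :: "(real ^ 'n) set"
  assumes K: "connected K" "0 \<in> K" "\<And>i. axis i 1 \<in> K" and e: "e > 0"
  shows "\<exists>z s. (\<forall>i. z $ i \<in> \<int>) \<and> s \<in> fold_sum CARD('n) K \<and> dist y (z + s) < e"
proof -
  \<comment> \<open>Each coordinate contributes an error below \<open>d\<close>, so the total error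
    stays below \<open>e\<close>.\<close>
  define d where "d = e / CARD('n)"
  have d: "d > 0" using e by (simp add: d_def)
  have "\<forall>i. \<exists>h :: real \<Rightarrow> real ^ 'n. continuous_on UNIV h \<and> bounded (range (\<lambda>t. h t - t *\<^sub>R axis i 1)) \<and>
    (\<forall>t. \<exists>k\<in>K. \<exists>m\<in>\<int>. dist (h t) (k + m *\<^sub>R axis i 1) < d)" (is "\<forall>i. \<exists>h. ?P i h")
  proof
    fix i :: 'n
    obtain p where p: "path p" "pathstart p = 0" "pathfinish p = axis i (1::real)"
      "\<And>s. s \<in> {0..1} \<Longrightarrow> \<exists>k\<in>K. dist (p s) k < d"
      using path_near_connected[OF K(1,2) K(3)[of i] d] by blast
    obtain h where h: "continuous_on UNIV h" "bounded (range (\<lambda>t. h t - t *\<^sub>R axis i 1))"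
      "\<And>t::real. \<exists>s\<in>{0..1}. \<exists>m\<in>\<int>. h t = p s + m *\<^sub>R axis i 1"
      using path_quasiperiodic_extension[OF p(1-3)] by blast
    have "\<exists>k\<in>K. \<exists>m\<in>\<int>. dist (h t) (k + m *\<^sub>R axis i 1) < d" for t
    proof -
      obtain s m where sm: "s \<in> {0..1}" "m \<in> \<int>" "h t = p s + m *\<^sub>R axis i 1"
        using h(3)[of t] by blast
      obtain k where "k \<in> K" "dist (p s) k < d" using p(4)[OF sm(1)] by blast
      with sm show ?thesis by (intro bexI[of _ k] bexI[of _ m]) auto
    qed
    with h(1,2) show "\<exists>h. ?P i h" by (intro exI[of _ h] conjI allI)
  qed
  then obtain h where "\<forall>i. ?P i (h i)" by (rule choice[THEN exE])
  then have h: "\<And>i. continuous_on UNIV (h i)" "\<And>i. bounded (range (\<lambda>t. h i t - t *\<^sub>R axis i 1))"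
      "\<And>i t. \<exists>k\<in>K. \<exists>m\<in>\<int>. dist (h i t) (k + m *\<^sub>R axis i 1) < d"
    by simp_all
  define f where "f x = (\<Sum>i\<in>UNIV. h i (x $ i))" for x
  have "surj f"
  proof (rule surj_of_bounded_perturbation)
    show "continuous_on UNIV f" unfolding f_def
      by (intro continuous_intros continuous_on_compose2[OF h(1)]) auto
    obtain B where B: "\<And>i t. norm (h i t - t *\<^sub>R axis i 1) \<le> B i"
      using h(2) unfolding bounded_iff by (metis rangeI)
    have "norm (f x - x) \<le> (\<Sum>i\<in>UNIV. B i)" for x
    proof -
      \<comment> \<open>Expanding \<open>x\<close> in unit vectors splits \<open>f x - x\<close>
        into the bounded deviations of the curves \<open>h i\<close> from the axes.\<close>
      have "x = (\<Sum>i\<in>UNIV. (x $ i) *\<^sub>R axis i 1)"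
        using basis_expansion[of x] by (simp add: scalar_mult_eq_scaleR)
      then have "f x - x = (\<Sum>i\<in>UNIV. h i (x $ i) - (x $ i) *\<^sub>R axis i 1)"
        unfolding f_def by (simp add: sum_subtractf)
      then show ?thesis using B by (simp add: sum_norm_le)
    qed
    then show "bounded (range (\<lambda>x. f x - x))" by (auto simp: bounded_iff)
  qed
  then obtain x where x: "y = f x" by blast
  obtain k m where km: "\<And>i. k i \<in> K" "\<And>i. m i \<in> \<int>"
    "\<And>i. dist (h i (x $ i)) (k i + m i *\<^sub>R axis i 1) < d"
  proof -
    have "\<forall>i. \<exists>k m. k \<in> K \<and> m \<in> \<int> \<and> dist (h i (x $ i)) (k + m *\<^sub>R axis i 1) < d"
      using h(3) by blast
    then show thesis using that by metis
  qed
  \<comment> \<open>The points of \<open>K\<close> are collected into one element of the sum, the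
    integer multiples of unit vectors into one lattice point.\<close>
  define s where "s = (\<Sum>i\<in>UNIV. k i)"
  define z :: "real ^ 'n" where "z = (\<chi> i. m i)"
  have "z = (\<Sum>i\<in>UNIV. m i *\<^sub>R axis i 1)"
    using basis_expansion[of z] by (simp add: scalar_mult_eq_scaleR z_def)
  then have "y - (z + s) = (\<Sum>i\<in>UNIV. h i (x $ i) - (k i + m i *\<^sub>R axis i 1))"
    by (simp add: x f_def s_def sum_subtractf sum.distrib algebra_simps)
  then have "dist y (z + s) \<le> (\<Sum>i\<in>UNIV. dist (h i (x $ i)) (k i + m i *\<^sub>R axis i 1))"
    by (simp add: dist_norm norm_sum)
  also have "\<dots> < (\<Sum>i\<in>(UNIV::'n set). d)" by (intro sum_strict_mono km) auto
  also have "\<dots> = e" by (simp add: d_def)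
  finally have "dist y (z + s) < e" .
  moreover have "s \<in> fold_sum CARD('n) K" unfolding s_def by (rule sum_UNIV_in_fold_sum[OF km(1)])
  moreover have "\<forall>i. z $ i \<in> \<int>" using km by (simp add: z_def)
  ultimately show ?thesis by blast
qed

lemma closed_lattice: "closed {z :: real ^ 'n. \<forall>i. z $ i \<in> \<int>}"
proof -
  have "{z :: real ^ 'n. \<forall>i. z $ i \<in> \<int>} = (\<Inter>i. (\<lambda>z. z $ i) -` \<int>)" by auto
  then show ?thesis by (auto intro!: closed_INT closed_vimage continuous_intros)
qed

lemma countable_lattice: "countable {z :: real ^ 'n. \<forall>i. z $ i \<in> \<int>}"
proof (rule countable_subset)
  show "{z :: real ^ 'n. \<forall>i. z $ i \<in> \<int>} \<subseteq> range (\<lambda>m :: 'n \<Rightarrow> int. \<chi> i. of_int (m i))"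
  proof
    fix z :: "real ^ 'n" assume "z \<in> {z. \<forall>i. z $ i \<in> \<int>}"
    then have "z = (\<chi> i. of_int \<lfloor>z $ i\<rfloor>)" by (simp add: vec_eq_iff)
    then show "z \<in> range (\<lambda>m :: 'n \<Rightarrow> int. \<chi> i. of_int (m i))" by (rule range_eqI[where x = "\<lambda>i. \<lfloor>z $ i\<rfloor>"])
  qed
qed simp

text \<open>Otherwise the complements of the translates would be countably many dense open sets with
  empty intersection, against Baire's theorem.\<close>

lemma interior_translate_of_countable_cover:
  fixes S :: "'a::euclidean_space set"
  assumes S: "closed S" and Z: "countable Z" and cover: "\<And>y. \<exists>z\<in>Z. \<exists>s\<in>S. y = z + s"
  shows "interior S \<noteq> {}"
proof
  assume "interior S = {}"
  let ?G = "(\<lambda>z. - ((+) z ` S)) ` Z"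
  have "UNIV \<subseteq> closure (\<Inter>?G)"
  proof (rule Baire)
    fix T assume "T \<in> ?G"
    then obtain z where z: "T = - ((+) z ` S)" by blast
    have "closed ((+) z ` S)" using S by (rule closed_translation)
    moreover have "interior ((+) z ` S) = {}"
      using \<open>interior S = {}\<close> by (simp add: interior_translation)
    ultimately show "openin (top_of_set UNIV) T \<and> UNIV \<subseteq> closure T"
      by (simp add: z closure_complement open_Compl)
  qed (use Z in auto)
  moreover have "\<Inter>?G = {}" using cover by blast
  ultimately show False by auto
qed

text \<open>The lattice translates of the sum have a dense union. This union is a closed set plus a
  compact one, hence closed, so it is the whole space.\<close>

lemma interior_fold_sum_axes:
  fixes K :: "(real ^ 'n) set"
  assumes K: "compact K" "connected K" "0 \<in> K" "\<And>i. axis i 1 \<in> K"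
  shows "interior (fold_sum CARD('n) K) \<noteq> {}"
proof (rule interior_translate_of_countable_cover[OF _ countable_lattice])
  let ?Z = "{z :: real ^ 'n. \<forall>i. z $ i \<in> \<int>}"
  let ?S = "fold_sum CARD('n) K"
  let ?U = "\<Union>x\<in>?Z. \<Union>y\<in>?S. {x + y}"
  show "closed ?S" using compact_fold_sum[OF K(1)] by (rule compact_imp_closed)
  have "closed ?U" by (intro closed_compact_sums closed_lattice compact_fold_sum K)
  moreover have "y \<in> closure ?U" for y
    unfolding closure_approachable
    using fold_sum_plus_lattice_dense[OF K(2-4), of _ y] by (fastforce simp: dist_commute)
  ultimately have "y \<in> ?U" for y by (simp add: closure_closed)
  then show "\<exists>z\<in>?Z. \<exists>s\<in>?S. y = z + s" for y by blast
qed

text \<open>Non-flatness makes the differences \<open>x - a\<close> span the space. A basis chosen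
  among them gives coordinates in which the continuum contains 0 and all unit vectors.\<close>

lemma interior_fold_sum_not_flat:
  fixes K :: "(real ^ 'n) set"
  assumes K: "compact K" "connected K" "\<not> flat K"
  shows "interior (fold_sum CARD('n) K) \<noteq> {}"
proof -
  have nf: "\<not> K \<subseteq> {x. a \<bullet> x = b}" if "a \<noteq> 0" for a b
    using K(3) that unfolding flat_iff_subset_hyperplane by blast
  \<comment> \<open>The empty set lies in every hyperplane, and a unit vector supplies a nonzero
    normal.\<close>
  then have "K \<noteq> {}" using axis_eq_0_iff by (metis empty_subsetI zero_neq_one)
  then obtain a where a: "a \<in> K" by blast
  let ?V = "(\<lambda>x. x - a) ` K"
  have span: "span ?V = UNIV"
  proof (rule ccontr)
    assume "span ?V \<noteq> UNIV"
    then obtain c where c: "c \<noteq> 0" "span ?V \<subseteq> {x. c \<bullet> x = 0}"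
      using span_not_univ_subset_hyperplane by blast
    have "c \<bullet> (x - a) = 0" if "x \<in> K" for x
      using c(2) that by (blast intro: span_base)
    then have "K \<subseteq> {x. c \<bullet> x = c \<bullet> a}" by (auto simp: inner_diff_right)
    with nf c(1) show False by blast
  qed
  obtain B where B: "B \<subseteq> ?V" "independent B" "?V \<subseteq> span B" "card B = dim ?V"
    by (rule basis_exists)
  have "dim ?V = CARD('n)" using span by (metis dim_UNIV dim_span DIM_cart DIM_real mult.right_neutral)
  then obtain \<beta> where \<beta>: "bij_betw \<beta> (UNIV :: 'n set) B"
    using B(4) finiteI_independent[OF B(2)] by (metis finite_same_card_bij finite)
  define L where "L x = (\<Sum>i\<in>UNIV. (x $ i) *\<^sub>R \<beta> i)" for x :: "real ^ 'n"
  have L: "linear L"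
    unfolding L_def by (auto intro!: linearI simp: scaleR_add_left sum.distrib scaleR_sum_right)
  have L_axis: "L (axis i 1) = \<beta> i" for i
    unfolding L_def axis_def by (simp add: if_distrib[of "\<lambda>c. c *\<^sub>R _"] cong: if_cong)
  have "B \<subseteq> range L" using \<beta> L_axis unfolding bij_betw_def by (metis image_subsetI rangeI)
  then have "span B \<subseteq> range L"
    using linear_subspace_image[OF L subspace_UNIV] by (rule span_minimal)
  moreover have "span B = UNIV"
    using B(3) span by (metis span_minimal subspace_span top.extremum_uniqueI)
  ultimately have "surj L" by blast
  then have inj: "inj L" using L by (simp add: linear_surjective_imp_injective)
  then obtain M where M: "linear M" "M \<circ> L = id" "L \<circ> M = id"
    using linear_injective_isomorphism[OF L] by (metis (no_types) comp_def eq_id_iff)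
  define K' where "K' = M ` ?V"
  have KK': "K = (\<lambda>x. L x + a) ` K'"
    using M(3) by (simp add: K'_def image_image pointfree_idE)
  have "K' = (\<lambda>x. M x - M a) ` K"
    by (simp add: K'_def image_image linear_diff[OF M(1)])
  moreover have "continuous_on K (\<lambda>x. M x - M a)"
    by (intro continuous_intros linear_continuous_on[OF linear_conv_bounded_linear[THEN iffD1, OF M(1)]])
  ultimately have "compact K'" "connected K'"
    using K by (auto intro: compact_continuous_image connected_continuous_image)
  moreover have "0 \<in> K'" using a by (auto simp: K'_def linear_0[OF M(1)] image_iff intro!: bexI[of _ a])
  moreover have "axis i 1 \<in> K'" for i
  proof -
    have "\<beta> i \<in> ?V" using \<beta> B(1) by (auto simp: bij_betw_def)
    moreover have "M (\<beta> i) = axis i 1" using L_axis M(2) by (metis pointfree_idE)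
    ultimately show ?thesis unfolding K'_def by (metis imageI)
  qed
  ultimately have "interior (fold_sum CARD('n) K') \<noteq> {}" by (rule interior_fold_sum_axes)
  moreover have "fold_sum CARD('n) K = (\<lambda>x. L x + real CARD('n) *\<^sub>R a) ` fold_sum CARD('n) K'"
    unfolding KK' by (rule fold_sum_image_affine[OF L])
  \<comment> \<open>Splits the affine map into a translation and an injective linear map, both of
    which carry interiors to interiors.\<close>
  then have "fold_sum CARD('n) K = (+) (real CARD('n) *\<^sub>R a) ` L ` fold_sum CARD('n) K'"
    by (simp add: image_image add.commute)
  ultimately show ?thesis
    by (simp add: interior_translation interior_injective_linear_image[OF L inj])
qed

subsection \<open>Equivalence of the conditions\<close>

theorem corollary1:
  fixes K :: "(real ^ 'n) set"
  assumes "compact K" and "connected K"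
  shows "(interior (fold_sum CARD('n) K) \<noteq> {} \<longleftrightarrow> emeasure lebesgue (fold_sum CARD('n) K) > 0) \<and>
    (interior (fold_sum CARD('n) K) \<noteq> {} \<longleftrightarrow> \<not> flat K) \<and>
    (interior (fold_sum CARD('n) K) \<noteq> {} \<longleftrightarrow>
      (\<forall>f :: real ^ 'n \<Rightarrow> real. linear f \<longrightarrow> continuous_on UNIV f \<longrightarrow> f \<noteq> (\<lambda>x. 0) \<longrightarrow>
         interior (f ` K) \<noteq> {})) \<and>
    (interior (fold_sum CARD('n) K) \<noteq> {} \<longleftrightarrow> K \<in> family_A) \<and>
    (interior (fold_sum CARD('n) K) \<noteq> {} \<longleftrightarrow> K \<in> family_B) \<and>
    (interior (fold_sum CARD('n) K) \<noteq> {} \<longleftrightarrow> K \<in> family_C)"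
proof -
  let ?S = "fold_sum CARD('n) K"
  have pos_measure: "emeasure lebesgue ?S > 0" if "interior ?S \<noteq> {}"
  proof -
    have "?S \<in> sets lebesgue"
      using compact_fold_sum[OF assms(1)] lmeasurable_compact by blast
    moreover have "\<not> negligible ?S"
      using that negligible_subset[OF _ interior_subset] open_not_negligible[OF open_interior] by blast
    ultimately show ?thesis
      by (simp add: negligible_iff_emeasure0 zero_less_iff_neq_zero)
  qed
  have not_flat: "\<not> flat K" if "emeasure lebesgue ?S > 0"
    using that negligible_fold_sum_flat[of K "CARD('n)"]
    by (auto simp: negligible_iff_null_sets null_setsD1)
  have interior: "interior ?S \<noteq> {}" if "\<not> flat K"
    using interior_fold_sum_not_flat[OF assms that] .
  have family_A: "K \<in> family_A" if "interior ?S \<noteq> {}"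
  proof (rule interior_fold_sum_imp_family_A[OF that])
    \<comment> \<open>The index type is nonempty, so a sum has at least one summand, which the empty
      set cannot supply.\<close>
    have "?S = {}" if "K = {}" using that by (auto simp: fold_sum_def intro!: exI[of _ 0])
    then show "K \<noteq> {}" using that by auto
  qed
  have "interior ?S \<noteq> {} \<longleftrightarrow> emeasure lebesgue ?S > 0" "interior ?S \<noteq> {} \<longleftrightarrow> \<not> flat K"
    using pos_measure not_flat interior by blast+
  \<comment> \<open>The implications run in a cycle from interior points through the three families
    to non-flatness and back.\<close>
  moreover have "interior ?S \<noteq> {} \<longleftrightarrow> K \<in> family_A" "interior ?S \<noteq> {} \<longleftrightarrow> K \<in> family_B"
    "interior ?S \<noteq> {} \<longleftrightarrow> K \<in> family_C"
    using family_A interior family_A_subset_family_B family_B_subset_family_C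
      family_C_imp_not_flat[of K] by blast+
  ultimately show ?thesis
    using flat_iff_image_functional[OF assms(2)] by simp
qed

end
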